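(* Let $\Omega\subset\mathbb{R}^n$ be open and let $p:\Omega\to[1,\infty)$ be measurable with $p^+=\operatorname{ess\,sup}_{\Omega}p<\infty$. Let $u_i\in\widetilde{\mathrm{BV}}^{p(\cdot)}(\Omega)$, $i=1,2,\dots$, be such that $u_i\to u$ in $L^{p(\cdot)}(\Omega)$. Then $$\varrho_{\widetilde{\mathrm{BV}}^{p(\cdot)}}(u)\le\liminf_{i\to\infty}\varrho_{\widetilde{\mathrm{BV}}^{p(\cdot)}}(u_i).$$
   Context: $L^{p(\cdot)}(\Omega)$ is the variable exponent Lebesgue space of measurable $u:\Omega\to\mathbb{R}$ (identified when equal a.e.) with $\int_\Omega |u/\lambda|^{p(x)}dx<\infty$ for some $\lambda>0$, with Luxemburg norm $\|u\|_{p(\cdot)}=\inf\{\lambda>0:\int_\Omega|u/\lambda|^{p(x)}dx\le 1\}$. $\mathrm{Lip}_{\mathrm{loc}}(\Omega)$ denotes the locally Lipschitz functions on $\Omega$. For $u\in L^{p(\cdot)}(\Omega)$ define $$\varrho_{\widetilde{\mathrm{BV}}^{p(\cdot)}}(u)=\inf\Big\{\liminf_{i\to\infty}\int_\Omega|\nabla u_i(x)|^{p(x)}dx\Big\}\in[0,\infty],$$ the infimum being over all sequences $(u_i)_{i=1}^\infty$ in $\mathrm{Lip}_{\mathrm{loc}}(\Omega)\cap L^{p(\cdot)}(\Omega)$ with $u_i\to u$ in $L^{p(\cdot)}(\Omega)$. Define $\widetilde{\mathrm{BV}}^{p(\cdot)}(\Omega)=\{u\in L^{p(\cdot)}(\Omega):\varrho_{\widetilde{\mathrm{BV}}^{p(\cdot)}}(u)<\infty\}$.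 *)

theory Defs
  imports "HOL-Analysis.Analysis" "HOL-Probability.Essential_Supremum"
begin

text \<open>
  Functions on an open set \<open>\<Omega>\<close> are represented by total functions on the ambient space; only
  their values on \<open>\<Omega>\<close> matter. Elements of $L^{p(\cdot)}(\Omega)$ are represented by measurable
  functions rather than by classes modulo equality almost everywhere.
\<close>

definition vexp_modular ::
  "('a::euclidean_space \<Rightarrow> real) \<Rightarrow> 'a set \<Rightarrow> ('a \<Rightarrow> real) \<Rightarrow> ennreal"
  where "vexp_modular p \<Omega> u = (\<integral>\<^sup>+ x. ennreal (\<bar>u x\<bar> powr p x) \<partial>lebesgue_on \<Omega>)"

definition vexp_Lp ::
  "('a::euclidean_space \<Rightarrow> real) \<Rightarrow> 'a set \<Rightarrow> ('a \<Rightarrow> real) set"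
  where "vexp_Lp p \<Omega> =
    {u. u \<in> borel_measurable (lebesgue_on \<Omega>) \<and>
        (\<exists>l>0. vexp_modular p \<Omega> (\<lambda>x. u x / l) < \<infinity>)}"

text \<open>The Luxemburg norm; as an infimum of reals it is meaningful only on \<^const>\<open>vexp_Lp\<close>.\<close>

definition vexp_norm ::
  "('a::euclidean_space \<Rightarrow> real) \<Rightarrow> 'a set \<Rightarrow> ('a \<Rightarrow> real) \<Rightarrow> real"
  where "vexp_norm p \<Omega> u = Inf {l. l > 0 \<and> vexp_modular p \<Omega> (\<lambda>x. u x / l) \<le> 1}"

definition vexp_converges ::
  "('a::euclidean_space \<Rightarrow> real) \<Rightarrow> 'a set \<Rightarrow> (nat \<Rightarrow> 'a \<Rightarrow> real) \<Rightarrow> ('a \<Rightarrow> real) \<Rightarrow> bool"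
  where "vexp_converges p \<Omega> v u \<longleftrightarrow>
    (\<forall>i. v i \<in> vexp_Lp p \<Omega>) \<and> u \<in> vexp_Lp p \<Omega> \<and>
    (\<lambda>i. vexp_norm p \<Omega> (\<lambda>x. v i x - u x)) \<longlonglongrightarrow> 0"

definition Lip_loc :: "'a::euclidean_space set \<Rightarrow> ('a \<Rightarrow> real) set"
  where "Lip_loc \<Omega> = {u. \<forall>x\<in>\<Omega>. \<exists>r>0. \<exists>L. L-lipschitz_on (cball x r \<inter> \<Omega>) u}"

text \<open>
  The value 0 at points of non-differentiability is immaterial: by Rademacher's theorem a
  locally Lipschitz function on an open set is differentiable almost everywhere.
\<close>

definition gradient :: "('a::euclidean_space \<Rightarrow> real) \<Rightarrow> 'a \<Rightarrow> 'a"
  where "gradient u x = (if \<exists>D. GDERIV u x :> D then THE D. GDERIV u x :> D else 0)"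

lemma gradient_eqI:
  assumes "GDERIV u x :> D"
  shows "gradient u x = D"
proof -
  have "E = D" if "GDERIV u x :> E" for E
  proof -
    have "(\<lambda>h. inner h E) = (\<lambda>h. inner h D)"
      using that assms unfolding gderiv_def by (rule has_derivative_unique)
    then show ?thesis
      by (metis vector_eq_rdot inner_commute)
  qed
  with assms have "(THE D. GDERIV u x :> D) = D"
    by (intro the_equality)
  with assms show ?thesis
    by (auto simp: gradient_def)
qed

definition gradient_energy ::
  "('a::euclidean_space \<Rightarrow> real) \<Rightarrow> 'a set \<Rightarrow> ('a \<Rightarrow> real) \<Rightarrow> ennreal"
  where "gradient_energy p \<Omega> u =
    (\<integral>\<^sup>+ x. ennreal (norm (gradient u x) powr p x) \<partial>lebesgue_on \<Omega>)"

definition rho_BV ::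
  "('a::euclidean_space \<Rightarrow> real) \<Rightarrow> 'a set \<Rightarrow> ('a \<Rightarrow> real) \<Rightarrow> ennreal"
  where "rho_BV p \<Omega> u =
    Inf {liminf (\<lambda>i. gradient_energy p \<Omega> (v i)) | v.
          (\<forall>i. v i \<in> Lip_loc \<Omega> \<inter> vexp_Lp p \<Omega>) \<and> vexp_converges p \<Omega> v u}"

definition BV_tilde ::
  "('a::euclidean_space \<Rightarrow> real) \<Rightarrow> 'a set \<Rightarrow> ('a \<Rightarrow> real) set"
  where "BV_tilde p \<Omega> = {u \<in> vexp_Lp p \<Omega>. rho_BV p \<Omega> u < \<infinity>}"

end

theory Submission
  imports Defs
begin

text \<open>
  A diagonal argument: if \<open>c\<close> exceeds the lower limit on the right, then infinitely many \<open>us i\<close>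
  have \<open>rho_BV\<close> below \<open>c\<close>, and each of them is a limit of locally Lipschitz functions infinitely
  many of which have energy below \<open>c\<close>. Choosing one such function close to \<open>us i\<close> for a suitable
  \<open>i\<close> at each stage gives a sequence that converges to \<open>u\<close>. Only a triangle inequality up to a
  constant is needed for this, and it follows from
  \<open>\<bar>a + b\<bar> / (k + l) \<le> max (\<bar>a\<bar> / k) (\<bar>b\<bar> / l)\<close> without convexity.
\<close>

lemma measurable_abs_powr:
  fixes u p :: "'a::euclidean_space \<Rightarrow> real"
  assumes "p \<in> borel_measurable M" and "u \<in> borel_measurable M"
  shows "(\<lambda>x. ennreal (\<bar>u x / l\<bar> powr p x)) \<in> borel_measurable M"
  using assms by measurable

text \<open>The quotient on the left is the convex combination of \<open>a / k\<close> and
  \<open>b / l\<close> with weights \<open>k / (k + l)\<close> and \<open>l / (k + l)\<close>, so it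
  cannot exceed the larger one in absolute value.\<close>

lemma abs_add_divide_le_max:
  fixes a b :: real
  assumes "0 < k" and "0 < l"
  shows "\<bar>(a + b) / (k + l)\<bar> \<le> max \<bar>a / k\<bar> \<bar>b / l\<bar>"
proof -
  define m where "m = max \<bar>a / k\<bar> \<bar>b / l\<bar>"
  have "\<bar>a\<bar> = k * \<bar>a / k\<bar>" and "\<bar>b\<bar> = l * \<bar>b / l\<bar>"
    using assms by (auto simp: abs_mult)
  moreover have "k * \<bar>a / k\<bar> \<le> k * m" and "l * \<bar>b / l\<bar> \<le> l * m"
    using assms by (intro mult_left_mono; simp add: m_def)+
  ultimately have "\<bar>a + b\<bar> \<le> m * (k + l)"
    using abs_triangle_ineq[of a b] by (simp only: distrib_left mult.commute[of m])
  then show ?thesis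
    unfolding m_def[symmetric] using assms by (simp add: divide_le_eq)
qed

context
  fixes \<Omega> :: "'a::euclidean_space set" and p :: "'a \<Rightarrow> real"
  assumes p_measurable: "p \<in> borel_measurable (lebesgue_on \<Omega>)"
    and p_ge_1: "\<And>x. x \<in> \<Omega> \<Longrightarrow> 1 \<le> p x"
begin

text \<open>Pointwise, the power of a maximum is one of the two powers and hence at most their sum;
  only monotonicity of \<open>powr\<close> in its base enters. The price is that two modulars
  bounded by 1 give the bound 2, which has to be scaled away afterwards.\<close>

lemma vexp_modular_add_le:
  assumes "u \<in> borel_measurable (lebesgue_on \<Omega>)" "v \<in> borel_measurable (lebesgue_on \<Omega>)"
    and "0 < k" "0 < l"
  shows "vexp_modular p \<Omega> (\<lambda>x. (u x + v x) / (k + l))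
    \<le> vexp_modular p \<Omega> (\<lambda>x. u x / k) + vexp_modular p \<Omega> (\<lambda>x. v x / l)"
proof -
  have "vexp_modular p \<Omega> (\<lambda>x. (u x + v x) / (k + l)) \<le>
    (\<integral>\<^sup>+ x. ennreal (\<bar>u x / k\<bar> powr p x) + ennreal (\<bar>v x / l\<bar> powr p x) \<partial>lebesgue_on \<Omega>)"
    unfolding vexp_modular_def
  proof (rule nn_integral_mono)
    fix x assume "x \<in> space (lebesgue_on \<Omega>)"
    then have "0 \<le> p x" using p_ge_1[of x] by (simp add: space_restrict_space)
    then have "\<bar>(u x + v x) / (k + l)\<bar> powr p x \<le> max \<bar>u x / k\<bar> \<bar>v x / l\<bar> powr p x"
      by (intro powr_mono2 abs_add_divide_le_max assms) auto
    also have "\<dots> \<le> \<bar>u x / k\<bar> powr p x + \<bar>v x / l\<bar> powr p x"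
      by (simp add: max_def)
    finally show "ennreal (\<bar>(u x + v x) / (k + l)\<bar> powr p x)
      \<le> ennreal (\<bar>u x / k\<bar> powr p x) + ennreal (\<bar>v x / l\<bar> powr p x)"
      by (simp add: ennreal_plus[symmetric] ennreal_leI del: ennreal_plus)
  qed
  also have "\<dots> = vexp_modular p \<Omega> (\<lambda>x. u x / k) + vexp_modular p \<Omega> (\<lambda>x. v x / l)"
    unfolding vexp_modular_def
    by (intro nn_integral_add measurable_abs_powr p_measurable assms)
  finally show ?thesis .
qed

text \<open>Since \<open>1 / k\<close> lies in (0, 1] and the exponent is at least 1,
  \<open>(1 / k) powr p x\<close> is at most \<open>1 / k\<close>. Enlarging the scale thus pushes
  any finite modular below 1.\<close>

lemma vexp_modular_divide_le:
  assumes "u \<in> borel_measurable (lebesgue_on \<Omega>)" and "1 \<le> k"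
  shows "vexp_modular p \<Omega> (\<lambda>x. u x / (k * l)) \<le> ennreal (1 / k) * vexp_modular p \<Omega> (\<lambda>x. u x / l)"
proof -
  have "vexp_modular p \<Omega> (\<lambda>x. u x / (k * l)) \<le>
    (\<integral>\<^sup>+ x. ennreal (1 / k) * ennreal (\<bar>u x / l\<bar> powr p x) \<partial>lebesgue_on \<Omega>)"
    unfolding vexp_modular_def
  proof (rule nn_integral_mono)
    fix x assume "x \<in> space (lebesgue_on \<Omega>)"
    then have "1 \<le> p x" using p_ge_1[of x] by (simp add: space_restrict_space)
    then have "(1 / k) powr p x \<le> (1 / k) powr 1"
      using assms by (intro powr_mono') auto
    moreover have "\<bar>u x / (k * l)\<bar> powr p x = (1 / k) powr p x * \<bar>u x / l\<bar> powr p x"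
      using assms by (subst powr_mult[symmetric]) (auto simp: abs_mult abs_divide)
    ultimately have "\<bar>u x / (k * l)\<bar> powr p x \<le> 1 / k * \<bar>u x / l\<bar> powr p x"
      using assms by (simp add: mult_right_mono del: abs_divide times_divide_eq_left)
    then show "ennreal (\<bar>u x / (k * l)\<bar> powr p x)
      \<le> ennreal (1 / k) * ennreal (\<bar>u x / l\<bar> powr p x)"
      using assms by (subst ennreal_mult[symmetric]) (auto intro: ennreal_leI)
  qed
  also have "\<dots> = ennreal (1 / k) * vexp_modular p \<Omega> (\<lambda>x. u x / l)"
    unfolding vexp_modular_def
    by (intro nn_integral_cmult measurable_abs_powr p_measurable assms)
  finally show ?thesis .
qed

lemma vexp_Lp_add:
  assumes "u \<in> vexp_Lp p \<Omega>" and "v \<in> vexp_Lp p \<Omega>"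
  shows "(\<lambda>x. u x + v x) \<in> vexp_Lp p \<Omega>"
proof -
  obtain k l where kl: "0 < k" "0 < l" "vexp_modular p \<Omega> (\<lambda>x. u x / k) < \<infinity>"
      "vexp_modular p \<Omega> (\<lambda>x. v x / l) < \<infinity>"
    using assms by (auto simp: vexp_Lp_def)
  have meas: "u \<in> borel_measurable (lebesgue_on \<Omega>)" "v \<in> borel_measurable (lebesgue_on \<Omega>)"
    using assms by (auto simp: vexp_Lp_def)
  have "vexp_modular p \<Omega> (\<lambda>x. (u x + v x) / (k + l)) < \<infinity>"
    using vexp_modular_add_le[OF meas kl(1,2)] kl(3,4)
    by (auto simp: ennreal_add_less_top elim: le_less_trans)
  then show ?thesis
    using meas kl(1,2) by (auto simp: vexp_Lp_def intro!: exI[of _ "k + l"])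
qed

lemma vexp_Lp_diff:
  assumes "u \<in> vexp_Lp p \<Omega>" and "v \<in> vexp_Lp p \<Omega>"
  shows "(\<lambda>x. u x - v x) \<in> vexp_Lp p \<Omega>"
proof -
  have "(\<lambda>x. - v x) \<in> vexp_Lp p \<Omega>"
    using assms(2) by (simp add: vexp_Lp_def vexp_modular_def)
  then show ?thesis
    using vexp_Lp_add[OF assms(1), of "\<lambda>x. - v x"] by simp
qed

text \<open>A real \<open>Inf\<close> is a true infimum only for a nonempty set bounded below, so
  estimates of \<open>vexp_norm\<close> rest on these two facts.\<close>

lemma
  assumes "u \<in> vexp_Lp p \<Omega>"
  shows vexp_norm_set_nonempty: "{l. l > 0 \<and> vexp_modular p \<Omega> (\<lambda>x. u x / l) \<le> 1} \<noteq> {}"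
    and vexp_norm_nonneg: "0 \<le> vexp_norm p \<Omega> u"
proof -
  obtain l where l: "0 < l" "vexp_modular p \<Omega> (\<lambda>x. u x / l) < \<infinity>"
    and meas: "u \<in> borel_measurable (lebesgue_on \<Omega>)"
    using assms by (auto simp: vexp_Lp_def)
  then obtain m where m: "0 \<le> m" "vexp_modular p \<Omega> (\<lambda>x. u x / l) = ennreal m"
    by (cases "vexp_modular p \<Omega> (\<lambda>x. u x / l)") auto
  \<comment> \<open>The factor \<open>1 + m\<close> is at least 1 even when \<open>m\<close> is
    small, and it brings the modular down to \<open>m / (1 + m)\<close>.\<close>
  have "vexp_modular p \<Omega> (\<lambda>x. u x / ((1 + m) * l)) \<le> ennreal (1 / (1 + m)) * ennreal m"
    using vexp_modular_divide_le[OF meas, of "1 + m" l] m by simp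
  also have "\<dots> = ennreal (m / (1 + m))"
    using m by (simp add: ennreal_mult[symmetric])
  also have "\<dots> \<le> 1"
    using m by (simp add: ennreal_le_1)
  finally show ne: "{l. l > 0 \<and> vexp_modular p \<Omega> (\<lambda>x. u x / l) \<le> 1} \<noteq> {}"
    using l m by (auto intro!: exI[of _ "(1 + m) * l"])
  show "0 \<le> vexp_norm p \<Omega> u"
    unfolding vexp_norm_def using ne by (intro cInf_greatest) auto
qed

text \<open>The strict bounds yield admissible scales \<open>k < d\<close> and \<open>l < e\<close>
  without knowing that the infimum is attained. At scale \<open>k + l\<close> the modular is at most
  2, and doubling the scale halves it; this is the origin of the factor 2.\<close>

lemma vexp_norm_add_le:
  assumes "u \<in> vexp_Lp p \<Omega>" "v \<in> vexp_Lp p \<Omega>"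
    and "vexp_norm p \<Omega> u < d" "vexp_norm p \<Omega> v < e"
  shows "vexp_norm p \<Omega> (\<lambda>x. u x + v x) \<le> 2 * (d + e)"
proof -
  obtain k where k: "0 < k" "k < d" "vexp_modular p \<Omega> (\<lambda>x. u x / k) \<le> 1"
    using cInf_lessD[OF vexp_norm_set_nonempty[OF assms(1)]] assms(3)
    unfolding vexp_norm_def by auto
  obtain l where l: "0 < l" "l < e" "vexp_modular p \<Omega> (\<lambda>x. v x / l) \<le> 1"
    using cInf_lessD[OF vexp_norm_set_nonempty[OF assms(2)]] assms(4)
    unfolding vexp_norm_def by auto
  have meas: "u \<in> borel_measurable (lebesgue_on \<Omega>)" "v \<in> borel_measurable (lebesgue_on \<Omega>)"
    using assms by (auto simp: vexp_Lp_def)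
  have "vexp_modular p \<Omega> (\<lambda>x. (u x + v x) / (k + l)) \<le> 1 + 1"
    using vexp_modular_add_le[OF meas k(1) l(1)] add_mono[OF k(3) l(3)] by (rule order_trans)
  then have "ennreal (1 / 2) * vexp_modular p \<Omega> (\<lambda>x. (u x + v x) / (k + l))
      \<le> ennreal (1 / 2) * ennreal 2"
    by (intro mult_left_mono) auto
  also have "\<dots> = 1"
    by (subst ennreal_mult[symmetric]) auto
  finally have "vexp_modular p \<Omega> (\<lambda>x. (u x + v x) / (2 * (k + l))) \<le> 1"
    using vexp_modular_divide_le[of "\<lambda>x. u x + v x" 2 "k + l"] meas
    by (auto intro: order_trans)
  then have "vexp_norm p \<Omega> (\<lambda>x. u x + v x) \<le> 2 * (k + l)"
    unfolding vexp_norm_def using k l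
    by (intro cInf_lower) (auto intro!: bdd_belowI[of _ 0])
  then show ?thesis
    using k l by simp
qed

text \<open>Reduces the relaxed functional to a single competitor that is close to \<open>u\<close>
  and has small energy at once, the form needed for the diagonal choice.\<close>

lemma rho_BV_lessE:
  assumes "rho_BV p \<Omega> u < c" and "0 < e"
  obtains w where "w \<in> Lip_loc \<Omega> \<inter> vexp_Lp p \<Omega>" "gradient_energy p \<Omega> w < c"
    "vexp_norm p \<Omega> (\<lambda>x. w x - u x) < e"
proof -
  obtain v where v: "\<And>i. v i \<in> Lip_loc \<Omega> \<inter> vexp_Lp p \<Omega>" "vexp_converges p \<Omega> v u"
    and lim: "liminf (\<lambda>i. gradient_energy p \<Omega> (v i)) < c"
    using assms(1) by (auto simp: rho_BV_def Inf_less_iff)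
  have "\<forall>\<^sub>F i in sequentially. vexp_norm p \<Omega> (\<lambda>x. v i x - u x) < e"
    using v(2) assms(2) by (auto simp: vexp_converges_def intro: order_tendstoD(2))
  \<comment> \<open>Otherwise the energies would eventually be at least \<open>c\<close>, and so
    would their lower limit.\<close>
  moreover have "\<exists>\<^sub>F i in sequentially. gradient_energy p \<Omega> (v i) < c"
    using lim Liminf_bounded[of c "\<lambda>i. gradient_energy p \<Omega> (v i)" sequentially]
    by (force simp: frequently_def not_less)
  ultimately obtain i where "gradient_energy p \<Omega> (v i) < c"
      "vexp_norm p \<Omega> (\<lambda>x. v i x - u x) < e"
    using frequently_ex[OF frequently_eventually_conj] by blast
  with v(1) that show ?thesis by blast
qed

lemma rho_BV_lower_semicontinuous:
  assumes conv: "vexp_converges p \<Omega> us u"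
  shows "rho_BV p \<Omega> u \<le> liminf (\<lambda>i. rho_BV p \<Omega> (us i))"
\<comment> \<open>As \<open>ennreal\<close> is densely ordered, it suffices to bound the left side
  by every \<open>c\<close> strictly above the right side; if the latter is infinite, no such
  \<open>c\<close> exists.\<close>
proof (rule dense_ge)
  fix c assume c: "liminf (\<lambda>i. rho_BV p \<Omega> (us i)) < c"
  have Lp: "us i \<in> vexp_Lp p \<Omega>" "u \<in> vexp_Lp p \<Omega>" for i
    using conv by (auto simp: vexp_converges_def)
  have freq: "\<exists>\<^sub>F i in sequentially. rho_BV p \<Omega> (us i) < c"
    using c Liminf_bounded[of c "\<lambda>i. rho_BV p \<Omega> (us i)" sequentially]
    by (force simp: frequently_def not_less)
  \<comment> \<open>The index \<open>i\<close> is chosen anew for each \<open>k\<close>, so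
    infinitely many good indices suffice. The constant 4 is \<open>2 * (e + e)\<close> with
    \<open>e = inverse (real (Suc k))\<close>.\<close>
  have "\<exists>w. w \<in> Lip_loc \<Omega> \<inter> vexp_Lp p \<Omega> \<and> gradient_energy p \<Omega> w < c \<and>
      vexp_norm p \<Omega> (\<lambda>x. w x - u x) \<le> 4 * inverse (real (Suc k))" for k
  proof -
    define e where "e = inverse (real (Suc k))"
    have e: "0 < e" by (simp add: e_def)
    have "\<forall>\<^sub>F i in sequentially. vexp_norm p \<Omega> (\<lambda>x. us i x - u x) < e"
      using conv e by (auto simp: vexp_converges_def intro: order_tendstoD(2))
    with freq obtain i where i: "rho_BV p \<Omega> (us i) < c"
        "vexp_norm p \<Omega> (\<lambda>x. us i x - u x) < e"
      using frequently_ex[OF frequently_eventually_conj] by blast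
    obtain w where w: "w \<in> Lip_loc \<Omega> \<inter> vexp_Lp p \<Omega>" "gradient_energy p \<Omega> w < c"
        "vexp_norm p \<Omega> (\<lambda>x. w x - us i x) < e"
      using rho_BV_lessE[OF i(1) e] .
    have "vexp_norm p \<Omega> (\<lambda>x. (w x - us i x) + (us i x - u x)) \<le> 2 * (e + e)"
      using w(1) by (intro vexp_norm_add_le vexp_Lp_diff Lp w(3) i(2)) auto
    with w show ?thesis by (auto simp: e_def)
  qed
  then obtain w where w: "\<And>k. w k \<in> Lip_loc \<Omega> \<inter> vexp_Lp p \<Omega>"
      "\<And>k. gradient_energy p \<Omega> (w k) < c"
      "\<And>k. vexp_norm p \<Omega> (\<lambda>x. w k x - u x) \<le> 4 * inverse (real (Suc k))"
    by metis
  \<comment> \<open>The lower half of the squeeze that gives convergence of \<open>w\<close> to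
    \<open>u\<close>.\<close>
  have nonneg: "0 \<le> vexp_norm p \<Omega> (\<lambda>x. w k x - u x)" for k
    using w(1)[of k] Lp(2) by (intro vexp_norm_nonneg vexp_Lp_diff) auto
  have "(\<lambda>k. 4 * inverse (real (Suc k))) \<longlonglongrightarrow> 4 * 0"
    by (intro tendsto_mult tendsto_const LIMSEQ_inverse_real_of_nat)
  then have "(\<lambda>k. 4 * inverse (real (Suc k))) \<longlonglongrightarrow> 0"
    by (simp only: mult_zero_right)
  then have "(\<lambda>k. vexp_norm p \<Omega> (\<lambda>x. w k x - u x)) \<longlonglongrightarrow> 0"
    by (rule tendsto_sandwich[OF always_eventually always_eventually tendsto_const, rotated 2])
      (use nonneg w(3) in blast)+
  then have "vexp_converges p \<Omega> w u"
    using w(1) Lp by (auto simp: vexp_converges_def)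
  \<comment> \<open>The diagonal sequence now competes in the infimum defining
    \<open>rho_BV p \<Omega> u\<close>, and all its energies lie below \<open>c\<close>.\<close>
  with w(1) have "rho_BV p \<Omega> u \<le> liminf (\<lambda>k. gradient_energy p \<Omega> (w k))"
    unfolding rho_BV_def by (intro Inf_lower) blast
  also have "\<dots> \<le> liminf (\<lambda>k::nat. c)"
    using w(2) by (intro Liminf_mono always_eventually) (auto intro: less_imp_le)
  finally show "rho_BV p \<Omega> u \<le> c"
    by (simp add: Liminf_const)
qed

end

theorem theorem4p4:
  fixes \<Omega> :: "(real ^ 'n) set" and p :: "real ^ 'n \<Rightarrow> real"
    and u :: "real ^ 'n \<Rightarrow> real" and us :: "nat \<Rightarrow> real ^ 'n \<Rightarrow> real"
  assumes "open \<Omega>"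
    and "p \<in> borel_measurable (lebesgue_on \<Omega>)"
    and "\<And>x. x \<in> \<Omega> \<Longrightarrow> 1 \<le> p x"
    and "esssup (lebesgue_on \<Omega>) (\<lambda>x. ereal (p x)) < \<infinity>"
    and "\<And>i. us i \<in> BV_tilde p \<Omega>"
    and "vexp_converges p \<Omega> us u"
  shows "rho_BV p \<Omega> u \<le> liminf (\<lambda>i. rho_BV p \<Omega> (us i))"
  using assms(2,3,6) by (rule rho_BV_lower_semicontinuous)

end
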